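(* Let $N_S,N_R,N_D\ge 1$ be integers, let $\mathbf{H}_{DS}\in\mathbb{C}^{N_D\times N_S}$, $\mathbf{H}_{RS}\in\mathbb{C}^{N_R\times N_S}$, $\mathbf{H}_{DR}\in\mathbb{C}^{N_D\times N_R}$ be arbitrary matrices, let $\mathbf{H}=[\mathbf{H}_{DS}\;\mathbf{H}_{DR}]\in\mathbb{C}^{N_D\times(N_S+N_R)}$, let $\mathbf{D}_S=[\mathbf{I}\;\mathbf{0}]\in\mathbb{C}^{N_S\times(N_S+N_R)}$ and $\mathbf{D}_R=[\mathbf{0}\;\mathbf{I}]\in\mathbb{C}^{N_R\times(N_S+N_R)}$, and let $P_S,P_R>0$. For $\varepsilon>0$ define $$\mathcal{P}_\varepsilon=\big\{(\mathbf{C},\mathbf{R}) : \mathbf{C}\in\mathbb{C}^{N_S\times N_S},\ \mathbf{C}\succeq\varepsilon\mathbf{I},\ \mathbf{R}\in\mathbb{C}^{(N_S+N_R)\times(N_S+N_R)},\ \mathbf{R}\succeq\mathbf{0},\ \operatorname{tr}(\mathbf{C})+\operatorname{tr}(\mathbf{D}_S\mathbf{R}\mathbf{D}_S^{H})\le P_S,\ \operatorname{tr}(\mathbf{D}_R\mathbf{R}\mathbf{D}_R^{H})\le P_R\big\}.$$ For $\mathbf{C}_v,\mathbf{C}_w\succeq \mathbf{0}$ in $\mathbb{C}^{N_S\times N_S}$ let $$R_A(\mathbf{C}_v,\mathbf{C}_w)=\log_2\det(\mathbf{I}+\mathbf{H}_{DS}\mathbf{C}_v\mathbf{H}_{DS}^H)+\log_2\frac{\det(\mathbf{I}+\mathbf{H}_{RS}(\mathbf{C}_v+\mathbf{C}_w)\mathbf{H}_{RS}^H)}{\det(\mathbf{I}+\mathbf{H}_{RS}\mathbf{C}_v\mathbf{H}_{RS}^H)},$$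 and for $\mathbf{C}\succeq\mathbf{0}$ let $R_A^\star(\mathbf{C})=\max\{R_A(\mathbf{C}_v,\mathbf{C}_w): \mathbf{C}_v\succeq\mathbf{0},\ \mathbf{C}_w\succeq\mathbf{0},\ \mathbf{C}_v+\mathbf{C}_w\preceq\mathbf{C}\}$. Further let $R_B(\mathbf{C},\mathbf{R})=\log_2\det(\mathbf{I}+\mathbf{H}_{DS}\mathbf{C}\mathbf{H}_{DS}^H+\mathbf{H}\mathbf{R}\mathbf{H}^H)$. Then, for every $\varepsilon>0$, the optimization problem $$\max_{(\mathbf{C},\mathbf{R})\in\mathcal{P}_\varepsilon}\ \min\{R_A^\star(\mathbf{C}),\,R_B(\mathbf{C},\mathbf{R})\}$$ is a convex program, i.e., $\mathcal{P}_\varepsilon$ is a convex set and the objective $(\mathbf{C},\mathbf{R})\mapsto\min\{R_A^\star(\mathbf{C}),R_B(\mathbf{C},\mathbf{R})\}$ is concave on $\mathcal{P}_\varepsilon$.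
   Context: All matrices are complex; $\succeq$ and $\succ$ denote positive semidefiniteness and positive definiteness of Hermitian matrices (and $\mathbf{A}\preceq\mathbf{B}$ means $\mathbf{B}-\mathbf{A}\succeq\mathbf{0}$); $\cdot^H$ is the conjugate transpose; $\mathbf{I}$ and $\mathbf{0}$ are identity and zero matrices of appropriate sizes. This problem models the maximization of the partial decode-and-forward rate in a Gaussian MIMO relay channel with source S, relay R and destination D, where $\mathbf{C}$ is an (innovation) covariance matrix and $\mathbf{R}$ a joint covariance matrix. *)

theory Defs
  imports "HOL-Analysis.Analysis"
begin

text \<open>Complex matrices are rendered as complex^'n^'m (rows indexed by 'm, columns by 'n).
  The dimensions N_S, N_R, N_D are the cardinalities of finite index types 's, 'r, 'd;
  the stacked index set of size N_S+N_R is the sum type 's + 'r.\<close>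

definition cadj :: "complex^'n^'m \<Rightarrow> complex^'m^'n" where
  "cadj A = (\<chi> i j. cnj (A $ j $ i))"

definition hermitian :: "complex^'n^'n \<Rightarrow> bool" where
  "hermitian A \<longleftrightarrow> cadj A = A"

definition psd :: "complex^'n^'n \<Rightarrow> bool" where
  "psd A \<longleftrightarrow> hermitian A \<and>
     (\<forall>x::complex^'n. 0 \<le> Re (\<Sum>i\<in>UNIV. \<Sum>j\<in>UNIV. cnj (x $ i) * A $ i $ j * x $ j))"

definition blockH :: "complex^'s^'d \<Rightarrow> complex^'r^'d \<Rightarrow> complex^('s + 'r)^'d" where
  "blockH HDS HDR = (\<chi> d k. case k of Inl s \<Rightarrow> HDS $ d $ s | Inr r \<Rightarrow> HDR $ d $ r)"

definition DS :: "complex^('s::finite + 'r::finite)^'s" where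
  "DS = (\<chi> s k. if k = Inl s then 1 else 0)"

definition DR :: "complex^('s::finite + 'r::finite)^'r" where
  "DR = (\<chi> r k. if k = Inr r then 1 else 0)"

definition Peps :: "real \<Rightarrow> real \<Rightarrow> real \<Rightarrow>
    ((complex^'s::finite^'s) \<times> (complex^('s + 'r::finite)^('s + 'r))) set" where
  "Peps PS PR \<epsilon> = {(C, R). psd (C - mat (complex_of_real \<epsilon>)) \<and> psd R \<and>
      Re (trace C) + Re (trace ((DS :: complex^('s + 'r)^'s) ** R ** cadj (DS :: complex^('s + 'r)^'s))) \<le> PS \<and>
      Re (trace ((DR :: complex^('s + 'r)^'r) ** R ** cadj (DR :: complex^('s + 'r)^'r))) \<le> PR}"

definition RA :: "complex^'s^'d \<Rightarrow> complex^'s^'r \<Rightarrow> complex^'s^'s \<Rightarrow> complex^'s^'s \<Rightarrow> real" where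
  "RA HDS HRS Cv Cw =
     log 2 (Re (det (mat 1 + HDS ** Cv ** cadj HDS)))
     + log 2 (Re (det (mat 1 + HRS ** (Cv + Cw) ** cadj HRS))
              / Re (det (mat 1 + HRS ** Cv ** cadj HRS)))"

text \<open>R_A^*(C): the maximum (written as supremum; it is attained) of R_A over the
  admissible splittings.\<close>
definition RAstar :: "complex^'s^'d \<Rightarrow> complex^'s^'r \<Rightarrow> complex^'s^'s \<Rightarrow> real" where
  "RAstar HDS HRS C = Sup {RA HDS HRS Cv Cw | Cv Cw. psd Cv \<and> psd Cw \<and> psd (C - (Cv + Cw))}"

definition RB :: "complex^'s^'d \<Rightarrow> complex^'r^'d \<Rightarrow> complex^'s^'s \<Rightarrow> complex^('s + 'r)^('s + 'r) \<Rightarrow> real" where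
  "RB HDS HDR C R = log 2 (Re (det (mat 1 + HDS ** C ** cadj HDS
       + blockH HDS HDR ** R ** cadj (blockH HDS HDR))))"

end

theory Submission
  imports Defs
begin

text \<open>Put \<open>A = HDS\<^sup>H HDS\<close> and \<open>B = HRS\<^sup>H HRS\<close>. By Sylvester's determinant identity,
  \<open>RA\<close> depends only on \<open>A\<close>, \<open>B\<close> and the covariances. For every positive semidefinite \<open>N\<close>
  above both \<open>A\<close> and \<open>B\<close> (an enhanced channel), \<open>RA HDS HRS Cv Cw\<close> is at most
  \<open>log\<^sub>2 det (1 + C N)\<close> whenever \<open>Cv + Cw\<close> lies below \<open>C\<close>. For positive definite \<open>C\<close>, simultaneous
  diagonalisation of \<open>C\<^sup>-\<^sup>1 + A\<close> and \<open>C\<^sup>-\<^sup>1 + B\<close> produces an \<open>N\<close> and a splitting with equality.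
  Hence \<open>RAstar\<close> is on positive definite matrices a pointwise minimum, over a set of \<open>N\<close> that does
  not depend on \<open>C\<close>, of the concave functions \<open>log\<^sub>2 det (1 + C N)\<close>, and is therefore concave.\<close>

subsection \<open>Sylvester's determinant identity\<close>

lemma matrix_add_rdistrib: "(A + B) ** C = A ** C + B ** C"
  for A B :: "'a::semiring_1^'n^'m"
  by (vector matrix_matrix_mult_def sum.distrib[symmetric] field_simps)

lemma matrix_diff_ldistrib: "A ** (B - C) = A ** B - A ** C"
  for A :: "'a::ring_1^'n^'m"
  by (vector matrix_matrix_mult_def sum_subtractf[symmetric] algebra_simps)

lemma matrix_diff_rdistrib: "(A - B) ** C = A ** C - B ** C"
  for A B :: "'a::ring_1^'n^'m"
  by (vector matrix_matrix_mult_def sum_subtractf[symmetric] algebra_simps)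

lemma matrix_mult_uminus: "- A ** B = - (A ** B)" "A ** (- B) = - (A ** B)"
  for A :: "'a::ring_1^'n^'m"
  by (simp_all add: matrix_matrix_mult_def vec_eq_iff sum_negf)

lemmas matrix_ring_simps = matrix_add_ldistrib matrix_add_rdistrib
  matrix_diff_ldistrib matrix_diff_rdistrib matrix_mult_uminus

text \<open>Outside \<open>range f\<close> the rows of \<open>M\<close> are unit rows, so only
  permutations fixing every such index contribute to the Leibniz sum. Those are the permutations of
  \<open>range f\<close>, and transport along \<open>f\<close> preserves their sign and
  entries.\<close>

lemma det_embedding:
  fixes A :: "'a::comm_ring_1^'n^'n" and M :: "'a^'m^'m"
  assumes f: "inj f"
    and in_range: "\<And>i j. M $ f i $ f j = A $ i $ j"
    and off_range: "\<And>k l. k \<notin> range f \<Longrightarrow> M $ k $ l = (if k = l then 1 else 0)"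
  shows "det M = det A"
proof -
  let ?t = "\<lambda>p. of_int (sign p) * (\<Prod>k\<in>UNIV. M $ k $ p k)"
  let ?m = "map_permutation UNIV f"
  have "det M = sum ?t {p. p permutes UNIV}"
    by (simp add: det_def)
  also have "\<dots> = sum ?t {p. p permutes range f}"
  proof (rule sum.mono_neutral_right)
    show "\<forall>p\<in>{p. p permutes UNIV} - {p. p permutes range f}. ?t p = 0"
    proof
      fix p assume "p \<in> {p. p permutes (UNIV :: 'm set)} - {p. p permutes range f}"
      then have "p permutes UNIV" "\<not> p permutes range f" by auto
      then obtain k where "k \<notin> range f" "p k \<noteq> k"
        by (metis DiffD2 permutes_superset)
      then have "M $ k $ p k = 0"
        using off_range by auto
      then have "(\<Prod>k\<in>UNIV. M $ k $ p k) = 0"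
        by (meson UNIV_I finite prod_zero)
      then show "?t p = 0" by simp
    qed
  qed (auto intro: permutes_subset finite_permutations)
  also have "\<dots> = (\<Sum>q | q permutes UNIV. ?t (?m q))"
  proof (rule sum.reindex_bij_betw[symmetric])
    have b: "bij_betw f UNIV (range f)"
      using f by (simp add: bij_betw_imageI)
    show "bij_betw ?m {q. q permutes UNIV} {p. p permutes range f}"
    proof (rule bij_betw_byWitness[where f' = "map_permutation (range f) (inv f)"])
      show "?m ` {q. q permutes UNIV} \<subseteq> {p. p permutes range f}"
        using map_permutation_permutes[OF b] by auto
      have b': "bij_betw (inv f) (range f) UNIV"
        using bij_betw_inv_into[OF b] by simp
      show "map_permutation (range f) (inv f) ` {p. p permutes range f} \<subseteq> {q. q permutes UNIV}"
        using map_permutation_permutes[OF b'] by auto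
      show "\<forall>q\<in>{q. q permutes UNIV}. map_permutation (range f) (inv f) (?m q) = q"
        using f b b' by (auto intro!: map_permutation_compose_inv)
      show "\<forall>p\<in>{p. p permutes range f}. ?m (map_permutation (range f) (inv f) p) = p"
        using f b b' by (auto intro!: map_permutation_compose_inv simp: f_inv_into_f)
    qed
  qed
  also have "\<dots> = (\<Sum>q | q permutes UNIV. of_int (sign q) * (\<Prod>i\<in>UNIV. A $ i $ q i))"
  proof (rule sum.cong, simp)
    fix q assume "q \<in> {q. q permutes (UNIV :: 'n set)}"
    then have q: "q permutes UNIV" by simp
    have off: "M $ k $ ?m q k = 1" if "k \<notin> range f" for k
      using that off_range[OF that] by (simp add: map_permutation_def restrict_id_def)
    have "(\<Prod>k\<in>UNIV. M $ k $ ?m q k) = (\<Prod>k\<in>range f. M $ k $ ?m q k)"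
      by (rule prod.mono_neutral_right) (auto simp: off)
    also have "\<dots> = (\<Prod>i\<in>UNIV. A $ i $ q i)"
      by (subst prod.reindex[OF f]) (simp add: map_permutation_apply[OF f] in_range)
    finally show "?t (?m q) = of_int (sign q) * (\<Prod>i\<in>UNIV. A $ i $ q i)"
      using sign_map_permutation[OF f q] by simp
  qed
  finally show ?thesis
    by (simp add: det_def)
qed

text \<open>Sends the basis vector at \<open>i\<close> to the one at \<open>f i\<close>. Conjugating
  with it pads a matrix with zeros outside \<open>range f\<close>; with \<open>Inl\<close> and
  \<open>Inr\<close> this yields the blocks of a matrix over a sum type.\<close>

definition embedding_matrix :: "('n \<Rightarrow> 'm) \<Rightarrow> 'a::comm_ring_1^'n^'m" where
  "embedding_matrix f = (\<chi> k i. if k = f i then 1 else 0)"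

lemma transpose_embedding_mult:
  "transpose (embedding_matrix f) ** embedding_matrix g = (\<chi> i j. if f i = g j then 1 else 0)"
  by (simp add: transpose_def matrix_matrix_mult_def embedding_matrix_def vec_eq_iff mult_delta_left)

lemma embedding_conj_component:
  "(embedding_matrix f ** Z ** transpose (embedding_matrix f)) $ k $ l =
   (\<Sum>j\<in>UNIV. \<Sum>i\<in>UNIV. if k = f i \<and> l = f j then Z $ i $ j else 0)"
  by (auto simp: transpose_def matrix_matrix_mult_def embedding_matrix_def sum_distrib_right
      intro!: sum.cong)

lemma det_embedding_conj:
  fixes Z :: "'a::comm_ring_1^'n^'n" and f :: "'n \<Rightarrow> 'm::finite"
  assumes f: "inj f"
  shows "det (mat 1 + embedding_matrix f ** Z ** transpose (embedding_matrix f)) = det (mat 1 + Z)"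
proof (rule det_embedding[OF f])
  fix i j
  have "(\<Sum>j'\<in>UNIV. \<Sum>i'\<in>UNIV. if f i = f i' \<and> f j = f j' then Z $ i' $ j' else 0)
      = (\<Sum>j'\<in>UNIV. \<Sum>i'\<in>UNIV. if i' = i then (if j' = j then Z $ i' $ j' else 0) else 0)"
    using f by (intro sum.cong) (auto simp: inj_def)
  also have "\<dots> = Z $ i $ j" by (simp cong: if_cong)
  finally show "(mat 1 + embedding_matrix f ** Z ** transpose (embedding_matrix f)) $ f i $ f j = (mat 1 + Z) $ i $ j"
    using f by (simp add: embedding_conj_component mat_def inj_eq)
next
  fix k l assume "k \<notin> range f"
  then show "(mat 1 + embedding_matrix f ** Z ** transpose (embedding_matrix f)) $ k $ l = (if k = l then 1 else 0)"
    by (auto simp: embedding_conj_component mat_def intro!: sum.neutral)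
qed

text \<open>Both sides are read off from two factorisations of the block matrix with rows
  \<open>(1, -X)\<close> and \<open>(Y, 1)\<close>.\<close>
theorem det_one_plus_mult_commute:
  fixes X :: "'a::field^'n^'m" and Y :: "'a^'m^'n"
  shows "det (mat 1 + X ** Y) = det (mat 1 + Y ** X)"
proof -
  define F :: "'a^'m^('m + 'n)" where "F = embedding_matrix Inl"
  define G :: "'a^'n^('m + 'n)" where "G = embedding_matrix Inr"
  let ?F = "transpose F" and ?G = "transpose G"
  have FF: "?F ** F = mat 1" and GG: "?G ** G = mat 1" and FG: "?F ** G = 0" and GF: "?G ** F = 0"
    unfolding F_def G_def transpose_embedding_mult by (simp_all add: vec_eq_iff mat_def)
  have c: "?F ** (F ** Z) = Z" "?G ** (G ** Z') = Z'" "?F ** (G ** Z') = 0" "?G ** (F ** Z) = 0"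
    for Z :: "'a^('m + 'n)^'m" and Z' :: "'a^('m + 'n)^'n"
    by (simp_all add: matrix_mul_assoc FF GG FG GF)
  define L where "L = mat 1 + G ** Y ** ?F"
  define U where "U = mat 1 - F ** X ** ?G"
  note simps = matrix_ring_simps matrix_mul_assoc[symmetric] c
  \<comment> \<open>\<open>L\<close> and \<open>U\<close> are unitriangular. Explicit inverses show
    that their determinants are nonzero, which suffices to cancel them below.\<close>
  have "L ** (mat 1 - G ** Y ** ?F) = mat 1" "U ** (mat 1 + F ** X ** ?G) = mat 1"
    unfolding L_def U_def by (simp_all add: simps)
  then have nz: "det L \<noteq> 0" "det U \<noteq> 0"
    using invertible_right_inverse invertible_det_nz by blast+
  have "L ** (mat 1 + G ** (Y ** X) ** ?G) ** U = U ** (mat 1 + F ** (X ** Y) ** ?F) ** L"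
    unfolding L_def U_def by (simp add: simps)
  from arg_cong[OF this, of det] nz
  have "det (mat 1 + G ** (Y ** X) ** ?G) = det (mat 1 + F ** (X ** Y) ** ?F)"
    by (simp add: det_mul)
  then show ?thesis
    unfolding F_def G_def by (simp add: det_embedding_conj)
qed

subsection \<open>Hermitian and positive definite matrices\<close>

lemma cadj_component [simp]: "cadj A $ i $ j = cnj (A $ j $ i)"
  by (simp add: cadj_def)

lemma cadj_cadj [simp]: "cadj (cadj A) = A"
  by (simp add: vec_eq_iff)

lemma cadj_mult: "cadj (A ** B) = cadj B ** cadj A"
  by (simp add: vec_eq_iff matrix_matrix_mult_def mult.commute)

lemma cadj_add: "cadj (A + B) = cadj A + cadj B"
  by (simp add: vec_eq_iff)

lemma cadj_diff: "cadj (A - B) = cadj A - cadj B"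
  by (simp add: vec_eq_iff)

lemma cadj_scaleR: "cadj (c *\<^sub>R A) = c *\<^sub>R cadj A"
  by (simp add: vec_eq_iff)

lemma cadj_mat_1 [simp]: "cadj (mat 1) = mat 1"
  by (simp add: vec_eq_iff mat_def)

lemma inner_complex_vec: "x \<bullet> y = Re (\<Sum>i\<in>UNIV. cnj (x $ i) * y $ i)" for x y :: "complex^'n"
  by (simp add: inner_vec_def inner_complex_def)

text \<open>Identifies the double sum in \<open>psd\<close> with
  \<open>x \<bullet> (A *v x)\<close>, so that Hermitian forms can be handled through the real inner
  product.\<close>

lemma inner_matrix_vector:
  "x \<bullet> (A *v y) = Re (\<Sum>i\<in>UNIV. \<Sum>j\<in>UNIV. cnj (x $ i) * A $ i $ j * y $ j)"
  for A :: "complex^'n^'m"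
  by (simp add: inner_complex_vec matrix_vector_mult_def sum_distrib_left mult.assoc)

lemma inner_cadj: "(cadj A *v x) \<bullet> y = x \<bullet> (A *v y)" for A :: "complex^'n^'m"
proof -
  have "(cadj A *v x) \<bullet> y = Re (\<Sum>j\<in>UNIV. \<Sum>i\<in>UNIV. cnj (x $ i) * A $ i $ j * y $ j)"
    by (simp add: inner_complex_vec matrix_vector_mult_def sum_distrib_right sum_distrib_left mult_ac)
  also have "\<dots> = x \<bullet> (A *v y)"
    unfolding inner_matrix_vector by (subst sum.swap) simp
  finally show ?thesis .
qed

lemma hermitian_inner: "hermitian A \<Longrightarrow> (A *v x) \<bullet> y = x \<bullet> (A *v y)"
  using inner_cadj[of A x y] by (simp add: hermitian_def)

lemma psd_iff: "psd A \<longleftrightarrow> hermitian A \<and> (\<forall>x. 0 \<le> x \<bullet> (A *v x))"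
  by (simp add: psd_def inner_matrix_vector)

definition pd :: "complex^'n^'n \<Rightarrow> bool" where
  "pd A \<longleftrightarrow> hermitian A \<and> (\<forall>x. x \<noteq> 0 \<longrightarrow> 0 < x \<bullet> (A *v x))"

lemma pd_imp_psd: "pd A \<Longrightarrow> psd A"
  unfolding pd_def psd_iff by (metis inner_zero_left less_eq_real_def)

lemma hermitian_congruence: "hermitian A \<Longrightarrow> hermitian (cadj K ** A ** K)"
  by (simp add: hermitian_def cadj_mult matrix_mul_assoc)

lemma inner_congruence: "x \<bullet> ((cadj K ** A ** K) *v x) = (K *v x) \<bullet> (A *v (K *v x))"
  using inner_cadj[of "cadj K" x "A *v (K *v x)"]
  by (simp add: matrix_vector_mul_assoc matrix_mul_assoc)

lemma psd_congruence: "psd A \<Longrightarrow> psd (cadj K ** A ** K)"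
  by (simp add: psd_iff hermitian_congruence inner_congruence)

lemma psd_congruence': "psd A \<Longrightarrow> psd (K ** A ** cadj K)"
  using psd_congruence[of A "cadj K"] by simp

lemma pd_congruence:
  fixes A K :: "complex^'n^'n"
  assumes "pd A" "invertible K"
  shows "pd (cadj K ** A ** K)"
proof -
  have "K *v x \<noteq> 0" if "x \<noteq> 0" for x
    using that assms(2) unfolding invertible_left_inverse matrix_left_invertible_ker by blast
  then show ?thesis
    using assms(1) by (simp add: pd_def hermitian_congruence inner_congruence)
qed

lemma hermitian_add: "hermitian A \<Longrightarrow> hermitian B \<Longrightarrow> hermitian (A + B)"
  by (simp add: hermitian_def cadj_add)

lemma hermitian_diff: "hermitian A \<Longrightarrow> hermitian B \<Longrightarrow> hermitian (A - B)"
  by (simp add: hermitian_def cadj_diff)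

lemma hermitian_scaleR: "hermitian A \<Longrightarrow> hermitian (c *\<^sub>R A)"
  by (simp add: hermitian_def cadj_scaleR)

lemma scaleR_matrix_vector: "(c *\<^sub>R A) *v x = c *\<^sub>R (A *v x)" for A :: "complex^'n^'m"
  by (simp add: vec_eq_iff matrix_vector_mult_def scaleR_sum_right)

lemma matrix_vector_scaleR: "A *v (c *\<^sub>R x) = c *\<^sub>R (A *v x)" for A :: "complex^'n^'m"
  by (simp add: vec_eq_iff matrix_vector_mult_def scaleR_sum_right)

lemma psd_add: "psd A \<Longrightarrow> psd B \<Longrightarrow> psd (A + B)"
  by (simp add: psd_iff hermitian_add matrix_vector_mult_add_rdistrib inner_add_right)

lemma psd_scaleR: "psd A \<Longrightarrow> 0 \<le> c \<Longrightarrow> psd (c *\<^sub>R A)"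
  by (simp add: psd_iff hermitian_scaleR scaleR_matrix_vector)

lemma pd_add_psd: "pd A \<Longrightarrow> psd B \<Longrightarrow> pd (A + B)"
  by (simp add: pd_def psd_iff hermitian_add matrix_vector_mult_add_rdistrib inner_add_right
      add_pos_nonneg)

lemma psd_add_pd: "psd A \<Longrightarrow> pd B \<Longrightarrow> pd (A + B)"
  by (metis add.commute pd_add_psd)

lemma pd_scaleR: "pd A \<Longrightarrow> 0 < c \<Longrightarrow> pd (c *\<^sub>R A)"
  by (simp add: pd_def hermitian_scaleR scaleR_matrix_vector)

lemma pd_mat_1: "pd (mat 1)"
  by (simp add: pd_def hermitian_def)

lemma psd_0: "psd 0"
  by (simp add: psd_iff hermitian_def vec_eq_iff)

lemma psd_gram: "psd (cadj K ** K)"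
  using psd_congruence[OF pd_imp_psd[OF pd_mat_1], of K] by simp

lemma psd_imp_hermitian: "psd A \<Longrightarrow> hermitian A"
  by (simp add: psd_def)

lemma pd_imp_hermitian: "pd A \<Longrightarrow> hermitian A"
  by (simp add: pd_def)

lemma pd_invertible: "pd A \<Longrightarrow> invertible A"
  unfolding invertible_left_inverse matrix_left_invertible_ker pd_def
  by (metis inner_zero_right less_irrefl)

lemma invertible_obtain_inverse:
  fixes A :: "'a::field^'n^'n"
  assumes "invertible A"
  obtains B where "A ** B = mat 1" "B ** A = mat 1" "invertible B"
  using assms unfolding invertible_def by blast

lemma hermitian_inverse:
  assumes "hermitian A" "A ** B = mat 1"
  shows "hermitian B"
proof -
  have "cadj B ** A = mat 1"
    using assms by (metis cadj_mat_1 cadj_mult hermitian_def)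
  then show ?thesis
    using assms(2) unfolding hermitian_def
    by (metis matrix_mul_assoc matrix_mul_lid matrix_mul_rid)
qed

text \<open>\<open>B\<close> is congruent to \<open>A\<close> through itself:
  \<open>cadj B ** A ** B = B\<close>.\<close>

lemma pd_inverse:
  assumes "pd A" "A ** B = mat 1"
  shows "pd B"
proof -
  have B: "hermitian B"
    using assms hermitian_inverse pd_imp_hermitian by blast
  have "invertible B"
    using assms(2) invertible_left_inverse by blast
  then have "pd (cadj B ** A ** B)"
    using assms(1) pd_congruence by blast
  also have "cadj B ** A ** B = B"
    using B assms(2) by (simp add: hermitian_def matrix_mul_assoc[symmetric])
  finally show ?thesis .
qed

subsection \<open>Spectral theorem and simultaneous diagonalisation\<close>

text \<open>First-order condition at the minimum \<open>t = 0\<close>; it is applied below to a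
  maximiser of the Rayleigh quotient.\<close>

lemma nonneg_quadratic_imp_linear_zero:
  fixes a b :: real
  assumes "\<And>t. 0 \<le> 2 * t * a + t\<^sup>2 * b"
  shows "a = 0"
proof (rule ccontr)
  assume "a \<noteq> 0"
  \<comment> \<open>As \<open>c\<close> exceeds \<open>\<bar>b\<bar>\<close>, the choice
    \<open>t = - a / c\<close> gives the quadratic the value
    \<open>a\<^sup>2 * (b - 2 * c) / c\<^sup>2 < 0\<close>.\<close>
  define c where "c = \<bar>b\<bar> + 1"
  have c: "c > 0" "b - 2 * c < 0" by (simp_all add: c_def)
  have "0 \<le> (2 * (- a / c) * a + (- a / c)\<^sup>2 * b) * c\<^sup>2"
    using assms[of "- a / c"] by simp
  also have "\<dots> = a\<^sup>2 * (b - 2 * c)"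
    using c by (simp add: field_simps power2_eq_square)
  also have "\<dots> < 0"
    using c \<open>a \<noteq> 0\<close> by (simp add: mult_pos_neg)
  finally show False by simp
qed

text \<open>The kernel of \<open>M\<close> encodes a \<open>Q\<close>-invariant subspace. By
  compactness the Rayleigh quotient attains its maximum \<open>c\<close> on the unit sphere of that
  subspace, and a maximiser is an eigenvector.\<close>

lemma hermitian_maximal_eigenvector:
  fixes Q :: "complex^'n^'n" and M :: "complex^'n^'m"
  assumes Q: "hermitian Q"
    and invariant: "\<And>x. M *v x = 0 \<Longrightarrow> M *v (Q *v x) = 0"
    and nontrivial: "M *v u = 0" "u \<noteq> 0"
  obtains x and c :: real where "M *v x = 0" "norm x = 1" "Q *v x = c *\<^sub>R x"
proof -
  define S where "S = {x. M *v x = 0} \<inter> sphere 0 1"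
  have "compact S"
    unfolding S_def by (intro closed_Int_compact closed_Collect_eq continuous_intros) auto
  moreover have "u /\<^sub>R norm u \<in> S"
    using nontrivial by (simp add: S_def matrix_vector_scaleR)
  moreover have "continuous_on S (\<lambda>x. x \<bullet> (Q *v x))"
    by (intro continuous_intros)
  ultimately obtain x where x: "x \<in> S" and max: "\<And>y. y \<in> S \<Longrightarrow> y \<bullet> (Q *v y) \<le> x \<bullet> (Q *v x)"
    by (metis continuous_attains_sup empty_iff)
  define c where "c = x \<bullet> (Q *v x)"
  \<comment> \<open>The residual \<open>z\<close> stays in the subspace by invariance, so it is an
    admissible direction of perturbation.\<close>
  define z where "z = c *\<^sub>R x - Q *v x"
  have Mx: "M *v x = 0" and nx: "norm x = 1"
    using x by (auto simp: S_def)
  then have xx: "x \<bullet> x = 1"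
    by (simp add: norm_eq_sqrt_inner)
  have le: "y \<bullet> (Q *v y) \<le> c * (y \<bullet> y)" if "M *v y = 0" for y
  proof (cases "y = 0")
    case False
    have "y /\<^sub>R norm y \<in> S"
      using that False by (simp add: S_def matrix_vector_scaleR)
    from max[OF this] have "(y \<bullet> (Q *v y)) / (norm y)\<^sup>2 \<le> c"
      by (simp add: c_def matrix_vector_scaleR power2_eq_square divide_inverse mult_ac)
    then show ?thesis
      using False by (simp add: divide_le_eq power2_norm_eq_inner)
  qed simp
  have Mz: "M *v z = 0"
    by (simp add: z_def matrix_vector_mult_diff_distrib matrix_vector_scaleR Mx invariant)
  have "0 \<le> 2 * t * (z \<bullet> z) + t\<^sup>2 * (c * (z \<bullet> z) - z \<bullet> (Q *v z))" for t
  proof -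
    have "M *v (x + t *\<^sub>R z) = 0"
      by (simp add: matrix_vector_right_distrib matrix_vector_scaleR Mx Mz)
    note le[OF this]
    moreover have "(x + t *\<^sub>R z) \<bullet> (Q *v (x + t *\<^sub>R z)) =
        x \<bullet> (Q *v x) + t * (x \<bullet> (Q *v z)) + t * (z \<bullet> (Q *v x)) + t\<^sup>2 * (z \<bullet> (Q *v z))"
      by (simp add: matrix_vector_right_distrib matrix_vector_scaleR inner_add_left
          inner_add_right power2_eq_square distrib_left)
    moreover have "(x + t *\<^sub>R z) \<bullet> (x + t *\<^sub>R z) = 1 + 2 * t * (x \<bullet> z) + t\<^sup>2 * (z \<bullet> z)"
      by (simp add: inner_add_left inner_add_right inner_commute[of z x] xx power2_eq_square
          distrib_left)
    moreover have "x \<bullet> (Q *v z) = z \<bullet> (Q *v x)"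
      by (metis hermitian_inner[OF Q] inner_commute)
    \<comment> \<open>Expanding one factor \<open>z\<close> shows that the linear coefficient of the
      perturbed inequality is \<open>z \<bullet> z\<close>; the first-order condition then forces
      \<open>z = 0\<close>.\<close>
    moreover have "t * (z \<bullet> z) = t * (c * (x \<bullet> z)) - t * (z \<bullet> (Q *v x))"
      by (subst (2) z_def) (simp add: inner_diff_right inner_commute[of z x] right_diff_distrib)
    ultimately show ?thesis
      unfolding c_def[symmetric] by (simp add: distrib_left right_diff_distrib mult_ac)
  qed
  then have "z = 0"
    using nonneg_quadratic_imp_linear_zero inner_eq_zero_iff by blast
  then show thesis
    using that[OF Mx nx, of c] by (simp add: z_def)
qed

definition diag_mat :: "('n \<Rightarrow> real) \<Rightarrow> complex^'n^'n" where
  "diag_mat d = (\<chi> i j. if i = j then of_real (d i) else 0)"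

lemma diag_mat_mult_left: "(diag_mat d ** A) $ i $ j = d i * A $ i $ j"
  by (simp add: diag_mat_def matrix_matrix_mult_def mult_delta_left)

lemma diag_mat_mult_right: "(A ** diag_mat d) $ i $ j = A $ i $ j * d j"
  by (simp add: diag_mat_def matrix_matrix_mult_def mult_delta_right)

text \<open>Induction on the index set: the orthogonal complement of the eigenvectors found so far
  is invariant, and it is nonzero while an index remains, so it contains a further
  eigenvector.\<close>

lemma hermitian_orthonormal_eigenvectors:
  fixes Q :: "complex^'n^'n" and I :: "'n set"
  assumes Q: "hermitian Q"
  shows "\<exists>v d. \<forall>i\<in>I. Q *v v i = d i *\<^sub>R v i \<and>
    (\<forall>j\<in>I. (\<Sum>k\<in>UNIV. cnj (v i $ k) * v j $ k) = (if i = j then 1 else 0))"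
  using finite[of I]
proof (induction I rule: finite_induct)
  case (insert a I)
  \<comment> \<open>Orthogonality has to hold over the complex numbers, while the library inner
    product gives only the real part of this form.\<close>
  define cin :: "complex^'n \<Rightarrow> complex^'n \<Rightarrow> complex"
    where "cin = (\<lambda>x y. \<Sum>k\<in>UNIV. cnj (x $ k) * y $ k)"
  obtain v d where eig: "\<And>i. i \<in> I \<Longrightarrow> Q *v v i = d i *\<^sub>R v i"
    and orth: "\<And>i j. i \<in> I \<Longrightarrow> j \<in> I \<Longrightarrow> cin (v i) (v j) = (if i = j then 1 else 0)"
    using insert.IH unfolding cin_def by blast
  \<comment> \<open>The kernel of \<open>M\<close> is the orthogonal complement of the vectors
    \<open>v i\<close>. Row \<open>a\<close> of \<open>M\<close> vanishes because \<open>a\<close>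
    is not in \<open>I\<close>, so \<open>M\<close> is singular and the complement is
    nontrivial.\<close>
  define M :: "complex^'n^'n" where "M = (\<chi> i j. if i \<in> I then cnj (v i $ j) else 0)"
  have M: "M *v x = 0 \<longleftrightarrow> (\<forall>i\<in>I. cin (v i) x = 0)" for x
  proof -
    have "(M *v x) $ i = (if i \<in> I then cin (v i) x else 0)" for i
      by (simp add: M_def cin_def matrix_vector_mult_def)
    then show ?thesis by (auto simp: vec_eq_iff)
  qed
  have cin_Q: "cin x (Q *v y) = cin (Q *v x) y" for x y
  proof -
    have Qc: "cnj (Q $ i $ j) = Q $ j $ i" for i j
      using Q by (metis cadj_component hermitian_def)
    have "cin (Q *v x) y = (\<Sum>k\<in>UNIV. \<Sum>j\<in>UNIV. cnj (x $ j) * Q $ j $ k * y $ k)"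
      by (simp add: cin_def matrix_vector_mult_def sum_distrib_right sum_distrib_left Qc mult_ac)
    also have "\<dots> = cin x (Q *v y)"
      by (subst sum.swap) (simp add: cin_def matrix_vector_mult_def sum_distrib_left mult_ac)
    finally show ?thesis by simp
  qed
  have cin_scale: "cin (c *\<^sub>R x) y = c * cin x y" for c x y
    by (simp add: cin_def scaleR_conv_of_real[where 'a = complex] sum_distrib_left mult_ac)
  have cin_flip: "cin x y = cnj (cin y x)" for x y
    by (simp add: cin_def mult.commute)
  have "M *v (Q *v x) = 0" if "M *v x = 0" for x
    using that by (auto simp: M cin_Q eig cin_scale)
  moreover have "row a M = 0"
    using insert.hyps by (simp add: M_def row_def vec_eq_iff)
  then have "\<not> invertible M"
    by (simp add: invertible_det_nz det_zero_row)
  then obtain u where "M *v u = 0" "u \<noteq> 0"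
    unfolding invertible_left_inverse matrix_left_invertible_ker by blast
  ultimately obtain x c where x: "M *v x = 0" "norm x = 1" "Q *v x = c *\<^sub>R x"
    using hermitian_maximal_eigenvector[OF Q] by blast
  have "cin x x = of_real ((norm x)\<^sup>2)"
    by (simp add: cin_def norm_vec_def L2_set_def real_sqrt_pow2 sum_nonneg complex_norm_square
        mult.commute del: of_real_power)
  then have xx: "cin x x = 1"
    using x by simp
  have vx: "cin (v i) x = 0" "cin x (v i) = 0" if "i \<in> I" for i
    using x(1) that by (auto simp: M cin_flip[of x])
  define v' where "v' = v(a := x)"
  define d' where "d' = d(a := c)"
  have "\<forall>i\<in>insert a I. Q *v v' i = d' i *\<^sub>R v' i \<and>
      (\<forall>j\<in>insert a I. cin (v' i) (v' j) = (if i = j then 1 else 0))"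
    using insert.hyps by (auto simp: v'_def d'_def eig orth xx vx x)
  then show ?case
    unfolding cin_def by blast
qed simp

theorem hermitian_spectral:
  fixes Q :: "complex^'n^'n"
  assumes Q: "hermitian Q"
  obtains U :: "complex^'n^'n" and d where "cadj U ** U = mat 1" "U ** cadj U = mat 1" "Q = U ** diag_mat d ** cadj U"
proof -
  obtain v :: "'n \<Rightarrow> complex^'n" and d where eig: "\<And>i. Q *v v i = d i *\<^sub>R v i"
    and orth: "\<And>i j. (\<Sum>k\<in>UNIV. cnj (v i $ k) * v j $ k) = (if i = j then 1 else 0)"
    using hermitian_orthonormal_eigenvectors[OF Q, of UNIV] by blast
  define U :: "complex^'n^'n" where "U = (\<chi> k i. v i $ k)"
  have U: "cadj U ** U = mat 1"
    using orth by (simp add: vec_eq_iff matrix_matrix_mult_def U_def mat_def)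
  then have U': "U ** cadj U = mat 1"
    using matrix_left_right_inverse by blast
  have "(Q ** U) $ k $ i = (U ** diag_mat d) $ k $ i" for k i
    using arg_cong[OF eig[of i], of "\<lambda>y. y $ k"] unfolding diag_mat_mult_right
    by (simp add: U_def matrix_matrix_mult_def matrix_vector_mult_def scaleR_conv_of_real[where 'a = complex] mult_ac)
  then have "Q ** U = U ** diag_mat d"
    by (simp add: vec_eq_iff)
  then have "Q = U ** diag_mat d ** cadj U"
    using U' by (metis matrix_mul_assoc matrix_mul_rid)
  then show thesis
    using that U U' by blast
qed

subsection \<open>Concavity and monotonicity of the log-determinant\<close>

lemma det_cadj: "det (cadj A) = cnj (det A)"
proof -
  have "cadj A = transpose (\<chi> i j. cnj (A $ i $ j))"
    by (simp add: vec_eq_iff transpose_def)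
  then have "det (cadj A) = det (\<chi> i j. cnj (A $ i $ j))"
    by simp
  then show ?thesis
    by (simp add: det_def)
qed

lemma invertible_cadj: "invertible A \<Longrightarrow> invertible (cadj A)" for A :: "complex^'n^'n"
  by (simp add: invertible_det_nz det_cadj)

lemma det_diag_mat: "det (diag_mat d) = of_real (prod d UNIV)"
  by (subst det_diagonal) (simp_all add: diag_mat_def)

lemma mat_1_eq_diag_mat: "mat 1 = diag_mat (\<lambda>_. 1)"
  by (simp add: vec_eq_iff mat_def diag_mat_def)

lemma diag_mat_add: "diag_mat d + diag_mat e = diag_mat (\<lambda>i. d i + e i)"
  by (simp add: vec_eq_iff diag_mat_def)

lemma diag_mat_diff: "diag_mat d - diag_mat e = diag_mat (\<lambda>i. d i - e i)"
  by (simp add: vec_eq_iff diag_mat_def)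

lemma diag_mat_scaleR: "c *\<^sub>R diag_mat d = diag_mat (\<lambda>i. c * d i)"
  by (simp add: vec_eq_iff diag_mat_def scaleR_conv_of_real[where 'a = complex])

lemma diag_mat_mult: "diag_mat d ** diag_mat e = diag_mat (\<lambda>i. d i * e i)"
  unfolding vec_eq_iff diag_mat_mult_left by (simp add: diag_mat_def)

lemma cadj_diag_mat [simp]: "cadj (diag_mat d) = diag_mat d"
  by (simp add: vec_eq_iff diag_mat_def)

lemma inner_diag_mat: "x \<bullet> (diag_mat d *v x) = (\<Sum>i\<in>UNIV. d i * (cmod (x $ i))\<^sup>2)"
proof -
  have "(diag_mat d *v x) $ i = d i *\<^sub>R x $ i" for i
    by (simp add: diag_mat_def matrix_vector_mult_def mult_delta_left scaleR_conv_of_real)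
  then show ?thesis
    by (simp add: inner_vec_def dot_square_norm)
qed

lemma inner_diag_mat_axis: "axis i 1 \<bullet> (diag_mat d *v axis i 1) = d i"
proof -
  have "d k * (cmod ((axis i 1 :: complex^'a) $ k))\<^sup>2 = (if k = i then d i else 0)" for k
    by (simp add: axis_def)
  then show ?thesis
    unfolding inner_diag_mat by simp
qed

lemma psd_diag_mat_iff: "psd (diag_mat d) \<longleftrightarrow> (\<forall>i. 0 \<le> d i)"
proof
  assume "psd (diag_mat d)"
  then show "\<forall>i. 0 \<le> d i"
    by (metis psd_iff inner_diag_mat_axis)
next
  assume "\<forall>i. 0 \<le> d i"
  then show "psd (diag_mat d)"
    by (simp add: psd_iff hermitian_def inner_diag_mat sum_nonneg)
qed

lemma pd_diag_mat_imp_pos: "pd (diag_mat d) \<Longrightarrow> 0 < d i"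
  unfolding pd_def by (metis inner_diag_mat_axis axis_eq_0_iff zero_neq_one)

section \<open>Congruence, Gram factors and simultaneous diagonalisation\<close>

lemma congruence_inverse:
  fixes A K L :: "complex^'n^'n"
  assumes "K ** L = mat 1"
  shows "cadj L ** (cadj K ** A ** K) ** L = A"
proof -
  have "cadj L ** cadj K = mat 1"
    using assms by (metis cadj_mat_1 cadj_mult)
  moreover have "cadj L ** (cadj K ** A ** K) ** L = (cadj L ** cadj K) ** A ** (K ** L)"
    by (simp add: matrix_mul_assoc)
  ultimately show ?thesis
    using assms by simp
qed

lemma psd_congruence_cancel:
  fixes A K :: "complex^'n^'n"
  assumes "psd (cadj K ** A ** K)" "invertible K"
  shows "psd A"
proof -
  obtain L where "K ** L = mat 1"
    using assms(2) invertible_obtain_inverse by blast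
  then show ?thesis
    using congruence_inverse psd_congruence[OF assms(1), of L] by metis
qed

lemma pd_congruence_cancel:
  fixes A K :: "complex^'n^'n"
  assumes "pd (cadj K ** A ** K)" "invertible K"
  shows "pd A"
proof -
  obtain L where "K ** L = mat 1" "invertible L"
    using assms(2) invertible_obtain_inverse by blast
  then show ?thesis
    using congruence_inverse pd_congruence[OF assms(1), of L] by metis
qed

text \<open>The spectral theorem gives \<open>N = U ** diag_mat d ** cadj U\<close> with nonnegative
  \<open>d\<close>; take \<open>K\<close> to be the diagonal of square roots times
  \<open>cadj U\<close>.\<close>

lemma psd_obtain_gram:
  fixes N :: "complex^'n^'n"
  assumes "psd N"
  obtains K :: "complex^'n^'n" where "N = cadj K ** K"
proof -
  obtain U :: "complex^'n^'n" and d
    where U: "cadj U ** U = mat 1" and N: "N = U ** diag_mat d ** cadj U"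
    using hermitian_spectral psd_imp_hermitian[OF assms] by blast
  have "cadj U ** (U ** diag_mat d ** cadj U) ** U = diag_mat d"
    using congruence_inverse[of "cadj U" U "diag_mat d"] U by simp
  then have "psd (diag_mat d)"
    using psd_congruence[OF assms, of U] N by simp
  then have "diag_mat d = diag_mat (\<lambda>i. sqrt (d i)) ** diag_mat (\<lambda>i. sqrt (d i))"
    by (simp add: psd_diag_mat_iff diag_mat_mult)
  then have "N = cadj (diag_mat (\<lambda>i. sqrt (d i)) ** cadj U) ** (diag_mat (\<lambda>i. sqrt (d i)) ** cadj U)"
    unfolding N by (simp add: cadj_mult matrix_mul_assoc)
  then show thesis
    using that by blast
qed

lemma pd_obtain_gram:
  fixes P :: "complex^'n^'n"
  assumes "pd P"
  obtains K :: "complex^'n^'n" where "invertible K" "P = cadj K ** K"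
proof -
  obtain K :: "complex^'n^'n" where K: "P = cadj K ** K"
    using psd_obtain_gram pd_imp_psd[OF assms] by blast
  then have "det K \<noteq> 0"
    using pd_invertible[OF assms] by (auto simp: invertible_det_nz det_mul)
  then show thesis
    using that K invertible_det_nz by blast
qed

text \<open>Whiten \<open>P = cadj K ** K\<close> by the inverse \<open>L\<close> of
  \<open>K\<close>, then diagonalise \<open>cadj L ** Q ** L\<close> by a unitary \<open>U\<close>.
  The identity is unaffected by \<open>U\<close>, so \<open>R = cadj U ** K\<close> serves both
  matrices.\<close>

theorem pd_hermitian_simultaneous_diagonalization:
  fixes P Q :: "complex^'n^'n"
  assumes "pd P" "hermitian Q"
  obtains R :: "complex^'n^'n" and d
  where "invertible R" "P = cadj R ** R" "Q = cadj R ** diag_mat d ** R"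
proof -
  obtain K :: "complex^'n^'n" where K: "invertible K" "P = cadj K ** K"
    using pd_obtain_gram[OF assms(1)] by blast
  obtain L where L: "K ** L = mat 1" "L ** K = mat 1"
    using K(1) invertible_obtain_inverse by blast
  obtain U :: "complex^'n^'n" and d where U: "cadj U ** U = mat 1" "U ** cadj U = mat 1"
    and Q: "cadj L ** Q ** L = U ** diag_mat d ** cadj U"
    using hermitian_spectral[OF hermitian_congruence[OF assms(2), of L]] by blast
  define R where "R = cadj U ** K"
  have "invertible U"
    using U invertible_def by blast
  then have "invertible R"
    using K(1) by (simp add: R_def invertible_cadj invertible_mult)
  moreover have "cadj R ** R = cadj K ** (U ** cadj U) ** K"
    by (simp add: R_def cadj_mult matrix_mul_assoc)
  then have "P = cadj R ** R"
    using K(2) U(2) by simp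
  moreover have "cadj R ** diag_mat d ** R = cadj K ** (U ** diag_mat d ** cadj U) ** K"
    by (simp add: R_def cadj_mult matrix_mul_assoc)
  then have "Q = cadj R ** diag_mat d ** R"
    using congruence_inverse[OF L(2), of Q] Q by simp
  ultimately show thesis
    using that by blast
qed

lemma det_congruence_diag_mat:
  "det (cadj R ** diag_mat d ** R) = of_real ((cmod (det R))\<^sup>2 * prod d UNIV)"
proof -
  have "cnj (det R) * det R = of_real ((cmod (det R))\<^sup>2)"
    by (simp add: complex_norm_square mult.commute del: of_real_power)
  then show ?thesis
    by (simp add: det_mul det_cadj det_diag_mat)
qed

text \<open>Reality is recorded along with positivity because \<open>logdet\<close> reads only the
  real part, and \<open>Re\<close> is multiplicative only on real factors.\<close>

lemma pd_det:
  fixes P :: "complex^'n^'n"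
  assumes "pd P"
  shows "det P = of_real (Re (det P))" "0 < Re (det P)"
proof -
  obtain K :: "complex^'n^'n" where K: "invertible K" "P = cadj K ** K"
    using pd_obtain_gram[OF assms] by blast
  then have "det P = of_real ((cmod (det K))\<^sup>2)"
    using det_congruence_diag_mat[of K "\<lambda>_. 1"] by (simp add: mat_1_eq_diag_mat[symmetric])
  moreover have "det K \<noteq> 0"
    using K(1) invertible_det_nz by blast
  ultimately show "det P = of_real (Re (det P))" "0 < Re (det P)"
    by simp_all
qed

definition logdet :: "complex^'n^'n \<Rightarrow> real" where
  "logdet A = log 2 (Re (det A))"

text \<open>The factor \<open>(cmod (det R))\<^sup>2\<close> splits off, which reduces comparisons
  of two simultaneously diagonalised matrices to scalar facts about \<open>d\<close>.\<close>

lemma logdet_congruence_diag_mat: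
  fixes R :: "complex^'n^'n"
  assumes "invertible R" "\<And>i. 0 < d i"
  shows "logdet (cadj R ** diag_mat d ** R) = logdet (cadj R ** R) + (\<Sum>i\<in>UNIV. log 2 (d i))"
proof -
  have "det R \<noteq> 0"
    using assms(1) invertible_det_nz by blast
  moreover have "det (cadj R ** R) = of_real ((cmod (det R))\<^sup>2)"
    using det_congruence_diag_mat[of R "\<lambda>_. 1"] by (simp add: mat_1_eq_diag_mat[symmetric])
  moreover have "log 2 (prod d UNIV) = (\<Sum>i\<in>UNIV. log 2 (d i))"
    unfolding log_def sum_divide_distrib[symmetric] using assms(2) by (subst ln_prod) (auto simp: less_imp_neq[symmetric])
  moreover have "0 < prod d UNIV"
    using assms(2) by (simp add: prod_pos)
  ultimately show ?thesis
    unfolding logdet_def det_congruence_diag_mat Re_complex_of_real by (simp add: log_mult del: of_real_prod prod_zero_iff)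
qed

text \<open>After simultaneous diagonalisation, positivity of \<open>Q - P\<close> says that every
  generalised eigenvalue is at least 1.\<close>

lemma logdet_mono:
  fixes P Q :: "complex^'n^'n"
  assumes "pd P" "psd (Q - P)"
  shows "logdet P \<le> logdet Q"
proof -
  have "hermitian (P + (Q - P))"
    by (intro hermitian_add pd_imp_hermitian psd_imp_hermitian assms)
  then have "hermitian Q" by simp
  then obtain R :: "complex^'n^'n" and d where R: "invertible R" "P = cadj R ** R" "Q = cadj R ** diag_mat d ** R"
    using pd_hermitian_simultaneous_diagonalization[OF assms(1)] by blast
  have "Q - P = cadj R ** (diag_mat d - mat 1) ** R"
    unfolding R by (simp add: matrix_ring_simps)
  then have "psd (diag_mat d - mat 1)"
    using assms(2) R(1) psd_congruence_cancel by metis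
  then have d: "1 \<le> d i" for i
    by (simp add: mat_1_eq_diag_mat diag_mat_diff psd_diag_mat_iff)
  then have "logdet Q = logdet P + (\<Sum>i\<in>UNIV. log 2 (d i))"
    unfolding R using R(1) by (intro logdet_congruence_diag_mat) (auto intro: less_le_trans[OF zero_less_one])
  moreover have "0 \<le> log 2 (d i)" for i
    using d[of i] by (subst zero_le_log_cancel_iff) auto
  ultimately show ?thesis
    by (simp add: sum_nonneg)
qed

text \<open>Simultaneous diagonalisation turns the claim into concavity of the scalar logarithm
  between 1 and each \<open>d i\<close>.\<close>

lemma logdet_concave:
  fixes P Q :: "complex^'n^'n"
  assumes "pd P" "pd Q" "0 \<le> t" "t \<le> 1"
  shows "(1 - t) * logdet P + t * logdet Q \<le> logdet ((1 - t) *\<^sub>R P + t *\<^sub>R Q)"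
proof -
  obtain R :: "complex^'n^'n" and d where R: "invertible R" "P = cadj R ** R" "Q = cadj R ** diag_mat d ** R"
    using pd_hermitian_simultaneous_diagonalization[OF assms(1)] assms(2) pd_imp_hermitian by blast
  have d: "0 < d i" for i
    using pd_diag_mat_imp_pos pd_congruence_cancel assms(2) R by blast
  define e where "e = (\<lambda>i. (1 - t) * 1 + t * d i)"
  have e: "0 < e i" for i
    unfolding e_def using d[of i] assms(3,4)
    by (cases "t = 0") (auto intro: add_nonneg_pos)
  have "diag_mat e = (1 - t) *\<^sub>R mat 1 + t *\<^sub>R diag_mat d"
    by (simp add: e_def mat_1_eq_diag_mat diag_mat_add diag_mat_scaleR)
  then have "cadj R ** diag_mat e ** R = (1 - t) *\<^sub>R P + t *\<^sub>R Q"
    unfolding R by (simp add: matrix_ring_simps matrix_scalar_ac scalar_matrix_assoc[symmetric])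
  then have "logdet ((1 - t) *\<^sub>R P + t *\<^sub>R Q) = logdet P + (\<Sum>i\<in>UNIV. log 2 (e i))"
    using logdet_congruence_diag_mat[of R e] R(1,2) e by simp
  moreover have "logdet Q = logdet P + (\<Sum>i\<in>UNIV. log 2 (d i))"
    unfolding R using logdet_congruence_diag_mat[of R d] R(1) d by simp
  moreover have "t * log 2 (d i) \<le> log 2 (e i)" for i
    using concave_onD[OF log_concave[of 2], of t 1 "d i"] d[of i] assms(3,4)
    by (simp add: e_def)
  then have "t * (\<Sum>i\<in>UNIV. log 2 (d i)) \<le> (\<Sum>i\<in>UNIV. log 2 (e i))"
    unfolding sum_distrib_left by (rule sum_mono)
  ultimately show ?thesis
    by (simp add: algebra_simps)
qed

subsection \<open>Enhanced channels bound the rate from above\<close>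

text \<open>\<open>A\<close> stands for a channel Gram matrix \<open>H\<^sup>H H\<close>. By
  Sylvester's identity this is the usual rate of the channel \<open>H\<close>; in this form channels
  with different output dimensions are compared by the order on Gram matrices.\<close>

definition mimo_rate :: "complex^'n^'n \<Rightarrow> complex^'n^'n \<Rightarrow> real" where
  "mimo_rate C A = logdet (mat 1 + C ** A)"

lemma mimo_rate_commute: "mimo_rate C A = mimo_rate A C"
  by (simp add: mimo_rate_def logdet_def det_one_plus_mult_commute[of C A])

lemma pd_one_plus_congruence: "psd C \<Longrightarrow> pd (mat 1 + K ** C ** cadj K)"
  by (intro pd_add_psd pd_mat_1 psd_congruence')

lemma det_one_plus_conj: "det (mat 1 + K ** C ** cadj K) = det (mat 1 + C ** (cadj K ** K))"
  using det_one_plus_mult_commute[of K "C ** cadj K"] by (simp add: matrix_mul_assoc)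

lemma logdet_one_plus_conj: "logdet (mat 1 + K ** C ** cadj K) = mimo_rate C (cadj K ** K)"
  by (simp add: mimo_rate_def logdet_def det_one_plus_conj)

text \<open>\<open>X ** Y\<close> need not be Hermitian, but factoring
  \<open>Y = cadj K ** K\<close> and moving \<open>K\<close> to the front by Sylvester's identity
  gives a positive definite matrix with the same determinant.\<close>

lemma det_one_plus_psd_mult:
  fixes X Y :: "complex^'n^'n"
  assumes "psd X" "psd Y"
  shows "det (mat 1 + X ** Y) = of_real (Re (det (mat 1 + X ** Y)))" "0 < Re (det (mat 1 + X ** Y))"
proof -
  obtain K :: "complex^'n^'n" where K: "Y = cadj K ** K"
    using psd_obtain_gram[OF assms(2)] by blast
  have "pd (mat 1 + K ** X ** cadj K)"
    using assms(1) by (rule pd_one_plus_congruence)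
  from pd_det[OF this] show "det (mat 1 + X ** Y) = of_real (Re (det (mat 1 + X ** Y)))"
    "0 < Re (det (mat 1 + X ** Y))"
    unfolding K det_one_plus_conj by simp_all
qed

lemma psd_one_plus_mult_obtain_inverse:
  fixes X Y :: "complex^'n^'n"
  assumes "psd X" "psd Y"
  obtains T where "T ** (mat 1 + X ** Y) = mat 1" "(mat 1 + X ** Y) ** T = mat 1"
proof -
  have "invertible (mat 1 + X ** Y)"
    using det_one_plus_psd_mult(2)[OF assms] by (auto simp: invertible_det_nz)
  then show thesis
    using that by (rule invertible_obtain_inverse)
qed

lemma mimo_rate_mono:
  fixes X Y :: "complex^'n^'n"
  assumes "psd X" "psd (Y - X)" "psd E"
  shows "mimo_rate X E \<le> mimo_rate Y E"
proof -
  obtain K :: "complex^'n^'n" where K: "E = cadj K ** K"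
    using psd_obtain_gram[OF assms(3)] by blast
  have "psd (K ** (Y - X) ** cadj K)"
    using assms(2) by (rule psd_congruence')
  then have "psd ((mat 1 + K ** Y ** cadj K) - (mat 1 + K ** X ** cadj K))"
    by (simp add: matrix_ring_simps)
  then show ?thesis
    unfolding K logdet_one_plus_conj[symmetric]
    using logdet_mono pd_one_plus_congruence[OF assms(1)] by blast
qed

lemma mimo_rate_mono_right:
  fixes X Y :: "complex^'n^'n"
  assumes "psd X" "psd (Y - X)" "psd E"
  shows "mimo_rate E X \<le> mimo_rate E Y"
  using mimo_rate_mono[OF assms] by (simp only: mimo_rate_commute[of E])

text \<open>With \<open>N = cadj K ** K\<close>, the matrix \<open>mat 1 + K ** C ** cadj K\<close>
  is affine in \<open>C\<close>.\<close>

lemma mimo_rate_concave: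
  fixes C C' N :: "complex^'n^'n"
  assumes "psd C" "psd C'" "psd N" "0 \<le> t" "t \<le> 1"
  shows "(1 - t) * mimo_rate C N + t * mimo_rate C' N \<le> mimo_rate ((1 - t) *\<^sub>R C + t *\<^sub>R C') N"
proof -
  obtain K :: "complex^'n^'n" where K: "N = cadj K ** K"
    using psd_obtain_gram[OF assms(3)] by blast
  have "mat 1 + K ** ((1 - t) *\<^sub>R C + t *\<^sub>R C') ** cadj K
      = (1 - t) *\<^sub>R (mat 1 + K ** C ** cadj K) + t *\<^sub>R (mat 1 + K ** C' ** cadj K)"
    by (simp add: matrix_ring_simps matrix_scalar_ac scalar_matrix_assoc[symmetric] algebra_simps)
  then show ?thesis
    unfolding K logdet_one_plus_conj[symmetric]
    using logdet_concave[OF pd_one_plus_congruence pd_one_plus_congruence, of C C' t K K] assms by simp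
qed

section \<open>Effective channels under interference\<close>

lemma inverse_one_plus_mult_cadj:
  assumes "hermitian X" "hermitian Y" "T ** (mat 1 + X ** Y) = mat 1"
  shows "(mat 1 + Y ** X) ** cadj T = mat 1"
  using arg_cong[OF assms(3), of cadj] assms(1,2) by (simp add: cadj_mult cadj_add hermitian_def)

text \<open>\<open>T ** X\<close> is the congruence by \<open>T\<close> of
  \<open>X + X ** Y ** X\<close>. For invertible \<open>X\<close> it is the inverse of
  \<open>X\<^sup>-\<^sup>1 + Y\<close>; the form used here also covers singular
  \<open>X\<close>.\<close>

lemma psd_inverse_one_plus_mult:
  assumes X: "psd X" and Y: "psd Y" and T: "T ** (mat 1 + X ** Y) = mat 1"
  shows "psd (T ** X)"
proof -
  have T': "(mat 1 + Y ** X) ** cadj T = mat 1"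
    using inverse_one_plus_mult_cadj psd_imp_hermitian X Y T by blast
  have "cadj X = X"
    using psd_imp_hermitian[OF X] by (simp add: hermitian_def)
  then have "psd (X + X ** Y ** X)"
    using psd_add[OF X psd_congruence[OF Y, of X]] by simp
  then have "psd (T ** (X + X ** Y ** X) ** cadj T)"
    by (rule psd_congruence')
  also have "T ** (X + X ** Y ** X) ** cadj T = T ** X ** ((mat 1 + Y ** X) ** cadj T)"
    by (simp add: matrix_ring_simps matrix_mul_assoc)
  finally show ?thesis
    by (simp add: T')
qed

text \<open>Chain rule from \<open>mat 1 + B ** (V + E) = (mat 1 + B ** V) ** (mat 1 + T ** B **
  E)\<close>. The matrix \<open>T ** B\<close> is the effective Gram matrix seen by \<open>E\<close>
  when \<open>V\<close> acts as interference.\<close>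

lemma mimo_rate_add:
  fixes B V E T :: "complex^'n^'n"
  assumes B: "psd B" and V: "psd V" and E: "psd E" and T: "T ** (mat 1 + B ** V) = mat 1"
  shows "mimo_rate B (V + E) = mimo_rate B V + mimo_rate (T ** B) E"
proof -
  have T': "(mat 1 + B ** V) ** T = mat 1"
    using T matrix_left_right_inverse by blast
  have "(mat 1 + B ** V) ** (mat 1 + T ** B ** E) = mat 1 + B ** V + ((mat 1 + B ** V) ** T) ** (B ** E)"
    by (simp only: matrix_add_ldistrib matrix_mul_assoc matrix_mul_rid)
  also have "\<dots> = mat 1 + B ** (V + E)"
    by (simp add: T' matrix_add_ldistrib)
  finally have "det (mat 1 + B ** (V + E)) = det (mat 1 + B ** V) * det (mat 1 + T ** B ** E)"
    by (metis det_mul)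
  then have "det (mat 1 + B ** (V + E)) = of_real (Re (det (mat 1 + B ** V)) * Re (det (mat 1 + T ** B ** E)))"
    using det_one_plus_psd_mult(1)[OF B V]
      det_one_plus_psd_mult(1)[OF psd_inverse_one_plus_mult[OF B V T] E] by simp
  then show ?thesis
    unfolding mimo_rate_def logdet_def
    using det_one_plus_psd_mult(2)[OF B V]
      det_one_plus_psd_mult(2)[OF psd_inverse_one_plus_mult[OF B V T] E]
    by (simp add: log_mult)
qed

text \<open>A stronger channel stays stronger under the same interference: the difference equals
  \<open>T ** (W ** D) ** cadj T\<close>, where \<open>W\<close> inverts
  \<open>mat 1 + D ** (cadj T ** V)\<close> and \<open>W ** D\<close> is positive
  semidefinite.\<close>

lemma psd_inverse_one_plus_mult_mono:
  fixes B V D :: "complex^'n^'n"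
  assumes B: "psd B" and V: "psd V" and D: "psd D"
    and T: "T ** (mat 1 + B ** V) = mat 1" and T': "T' ** (mat 1 + (B + D) ** V) = mat 1"
  shows "psd (T' ** (B + D) - T ** B)"
proof -
  define S where "S = cadj T"
  have herm: "cadj V = V" "hermitian V" "hermitian B"
    using B V psd_imp_hermitian by (auto simp: hermitian_def)
  have S: "(mat 1 + V ** B) ** S = mat 1"
    unfolding S_def using inverse_one_plus_mult_cadj herm T by blast
  then have S': "S ** (mat 1 + V ** B) = mat 1"
    using matrix_left_right_inverse by blast
  have SV: "psd (S ** V)"
    using psd_inverse_one_plus_mult[OF V B S'] .
  then have VT: "V ** T = S ** V"
    using psd_imp_hermitian[OF SV] herm unfolding hermitian_def S_def by (metis cadj_mult cadj_cadj)
  obtain W where W: "W ** (mat 1 + D ** (S ** V)) = mat 1"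
    using psd_one_plus_mult_obtain_inverse[OF D SV] by blast
  have "psd (W ** D)"
    using psd_inverse_one_plus_mult[OF D SV W] .
  then have "psd (T ** (W ** D) ** S)"
    unfolding S_def by (rule psd_congruence')
  moreover have "T' ** (B + D) - T ** B = T ** (W ** D) ** S"
  proof -
    \<comment> \<open>This factorisation of \<open>mat 1 + (B + D) ** V\<close> gives
      \<open>T' = T ** W\<close> by uniqueness of inverses.\<close>
    have "(mat 1 + D ** (S ** V)) ** (mat 1 + B ** V) = mat 1 + B ** V + D ** V ** (T ** (mat 1 + B ** V))"
      unfolding VT[symmetric] by (simp only: matrix_add_rdistrib matrix_mul_assoc matrix_mul_lid)
    also have "\<dots> = mat 1 + (B + D) ** V"
      by (simp add: T matrix_add_rdistrib add.assoc)
    finally have fac: "(mat 1 + D ** (S ** V)) ** (mat 1 + B ** V) = mat 1 + (B + D) ** V" .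
    have "T ** W ** (mat 1 + (B + D) ** V) = T ** (W ** (mat 1 + D ** (S ** V))) ** (mat 1 + B ** V)"
      unfolding fac[symmetric] by (simp add: matrix_mul_assoc)
    then have "T ** W ** (mat 1 + (B + D) ** V) = mat 1"
      by (simp add: W T)
    then have "(mat 1 + (B + D) ** V) ** (T ** W) = mat 1"
      using matrix_left_right_inverse by blast
    then have "T' ** (mat 1 + (B + D) ** V) ** (T ** W) = T'"
      by (simp only: matrix_mul_assoc[symmetric] matrix_mul_rid)
    then have T'_eq: "T' = T ** W"
      by (simp only: T' matrix_mul_lid)
    \<comment> \<open>Resolvent identity, which collapses \<open>D - D ** (S ** V ** B)\<close> to
      \<open>D ** S\<close>.\<close>
    have SVB: "S ** V ** B = mat 1 - S"
      using S' by (simp add: matrix_add_ldistrib matrix_mul_assoc algebra_simps)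
    have "T' ** (B + D) - T ** B = T ** W ** (B + D - (mat 1 + D ** (S ** V)) ** B)"
    proof -
      have "T ** W ** ((mat 1 + D ** (S ** V)) ** B) = T ** (W ** (mat 1 + D ** (S ** V))) ** B"
        by (simp add: matrix_mul_assoc)
      then show ?thesis
        by (simp add: T'_eq matrix_diff_ldistrib W)
    qed
    also have "B + D - (mat 1 + D ** (S ** V)) ** B = D - D ** (S ** V ** B)"
      by (simp add: matrix_add_rdistrib matrix_mul_assoc)
    also have "\<dots> = D ** S"
      by (simp add: SVB matrix_diff_ldistrib)
    finally show ?thesis
      by (simp add: matrix_mul_assoc)
  qed
  ultimately show ?thesis by simp
qed

text \<open>By the chain rule, the gain from adding \<open>E\<close> to \<open>V\<close> is the rate
  of \<open>E\<close> over the effective channel, which grows with \<open>B\<close>.\<close>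

lemma mimo_rate_supermodular:
  fixes B D V E :: "complex^'n^'n"
  assumes B: "psd B" and D: "psd D" and V: "psd V" and E: "psd E"
  shows "mimo_rate B (V + E) + mimo_rate (B + D) V \<le> mimo_rate (B + D) (V + E) + mimo_rate B V"
proof -
  have BD: "psd (B + D)"
    using B D by (rule psd_add)
  obtain T where T: "T ** (mat 1 + B ** V) = mat 1"
    using psd_one_plus_mult_obtain_inverse[OF B V] by blast
  obtain T' where T': "T' ** (mat 1 + (B + D) ** V) = mat 1"
    using psd_one_plus_mult_obtain_inverse[OF BD V] by blast
  have "mimo_rate (T ** B) E \<le> mimo_rate (T' ** (B + D)) E"
    using psd_inverse_one_plus_mult[OF B V T] psd_inverse_one_plus_mult_mono[OF B V D T T'] E
    by (rule mimo_rate_mono)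
  then show ?thesis
    using mimo_rate_add[OF B V E T] mimo_rate_add[OF BD V E T'] by simp
qed

text \<open>Raising \<open>A\<close> to \<open>N\<close> increases the first term; raising
  \<open>B\<close> to \<open>N\<close> increases the difference of the other two, by
  supermodularity. The terms in \<open>V\<close> then cancel, and monotonicity in the covariance
  passes from \<open>V + W\<close> to \<open>C\<close>.\<close>

lemma mimo_rate_enhanced_bound:
  fixes A B N V W C :: "complex^'n^'n"
  assumes A: "psd A" and B: "psd B" and NA: "psd (N - A)" and NB: "psd (N - B)"
    and V: "psd V" and W: "psd W" and C: "psd (C - (V + W))"
  shows "mimo_rate V A + mimo_rate (V + W) B - mimo_rate V B \<le> mimo_rate C N"
proof -
  have N: "psd N"
    using psd_add[OF NA A] by simp
  have "mimo_rate V A \<le> mimo_rate V N"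
    using A NA V by (rule mimo_rate_mono_right)
  moreover have "mimo_rate (V + W) B + mimo_rate V N \<le> mimo_rate (V + W) N + mimo_rate V B"
    using mimo_rate_supermodular[OF B NB V W]
    by (simp add: mimo_rate_commute[of B] mimo_rate_commute[of N])
  moreover have "mimo_rate (V + W) N \<le> mimo_rate C N"
    using psd_add[OF V W] C N by (rule mimo_rate_mono)
  ultimately show ?thesis by simp
qed

subsection \<open>Attainment of the bound, and concavity\<close>

text \<open>\<open>E\<close> is an orthogonal projection: the first summand is positive wherever
  \<open>E *v x\<close> is nonzero, and otherwise the second one is. Padding with
  \<open>mat 1 - E\<close> lets \<open>M\<close> be inverted on the range of \<open>E\<close> within
  the same dimension.\<close>

lemma pd_compression:
  fixes M E :: "complex^'n^'n"
  assumes M: "pd M" and E: "cadj E = E" "E ** E = E"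
  shows "pd (E ** M ** E + (mat 1 - E))"
proof -
  let ?F = "mat 1 - E"
  have F: "cadj ?F ** ?F = ?F"
    by (simp add: cadj_diff E matrix_ring_simps)
  have psd1: "psd (E ** M ** E)"
    using psd_congruence[OF pd_imp_psd[OF M], of E] E by simp
  have psd2: "psd ?F"
    using psd_gram[of ?F] F by simp
  have "0 < x \<bullet> ((E ** M ** E + ?F) *v x)" if "x \<noteq> 0" for x
  proof -
    have "x \<bullet> ((E ** M ** E) *v x) = (E *v x) \<bullet> (M *v (E *v x))"
      using inner_congruence[of x E M] E by simp
    then have "0 < x \<bullet> ((E ** M ** E) *v x) \<or> (E *v x = 0 \<and> 0 < x \<bullet> (?F *v x))"
      using M that by (cases "E *v x = 0") (auto simp: pd_def matrix_vector_mult_diff_rdistrib)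
    then show ?thesis
      using psd1 psd2 unfolding psd_iff matrix_vector_mult_add_rdistrib inner_add_right
      by (metis add_nonneg_pos add_pos_nonneg)
  qed
  then show ?thesis
    using psd1 psd2 by (simp add: pd_def hermitian_add psd_imp_hermitian)
qed

text \<open>In coordinates in which \<open>Ci + B\<close> is the identity and \<open>Ci + A\<close> is diagonal
  (\<open>Ci\<close> being the inverse of \<open>C\<close>), the worst enhanced channel replaces each generalised eigenvalue
  \<open>d i\<close> by \<open>max (d i) 1\<close>, and the optimal \<open>V\<close> uses exactly the eigendirections with \<open>d i > 1\<close>.\<close>
lemma mimo_rate_enhanced_attained:
  fixes A B C :: "complex^'n^'n"
  assumes C: "pd C" and A: "psd A" and B: "psd B"
  obtains N V where "psd (N - A)" "psd (N - B)" "psd V" "psd (C - V)"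
    "mimo_rate V A + mimo_rate C B - mimo_rate V B = mimo_rate C N"
proof -
  obtain Ci where Ci: "C ** Ci = mat 1" "Ci ** C = mat 1"
    using invertible_obtain_inverse[OF pd_invertible[OF C]] by blast
  have pCi: "pd Ci"
    using pd_inverse[OF C Ci(1)] .
  obtain R :: "complex^'n^'n" and d where R: "invertible R"
    and RB: "Ci + B = cadj R ** R" and RA: "Ci + A = cadj R ** diag_mat d ** R"
    using pd_hermitian_simultaneous_diagonalization[OF pd_add_psd[OF pCi B]
        pd_imp_hermitian[OF pd_add_psd[OF pCi A]]] by blast
  obtain S where S: "R ** S = mat 1" "S ** R = mat 1" "invertible S"
    using invertible_obtain_inverse[OF R] by blast
  define m where "m = (\<lambda>i. max (d i) 1)"
  define N where "N = cadj R ** diag_mat m ** R - Ci"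

  have "N - A = cadj R ** (diag_mat m - diag_mat d) ** R"
    using RA by (simp add: N_def matrix_ring_simps algebra_simps)
  moreover have "psd (diag_mat m - diag_mat d)"
    by (simp add: diag_mat_diff psd_diag_mat_iff m_def)
  ultimately have NA: "psd (N - A)"
    using psd_congruence by metis
  have "N - B = cadj R ** (diag_mat m - mat 1) ** R"
    using RB by (simp add: N_def matrix_ring_simps algebra_simps)
  moreover have "psd (diag_mat m - mat 1)"
    by (simp add: mat_1_eq_diag_mat diag_mat_diff psd_diag_mat_iff m_def)
  ultimately have NB: "psd (N - B)"
    using psd_congruence by metis

  have m_pos: "0 < prod m UNIV"
    by (rule prod_pos) (auto simp: m_def less_max_iff_disj)
  \<comment> \<open>Factoring out \<open>C\<close> compares \<open>Ci + N\<close> with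
    \<open>Ci + B\<close>, whose determinants differ exactly by the factor
    \<open>prod m UNIV\<close>.\<close>
  have "mat 1 + C ** N = C ** (cadj R ** diag_mat m ** R)"
    by (simp add: N_def matrix_diff_ldistrib Ci)
  moreover have "mat 1 + C ** B = C ** (Ci + B)"
    by (simp add: matrix_add_ldistrib Ci)
  ultimately have "det (mat 1 + C ** N) = det (mat 1 + C ** B) * of_real (prod m UNIV)"
    by (simp add: RB det_mul det_diag_mat)
  then have CN: "mimo_rate C N = mimo_rate C B + log 2 (prod m UNIV)"
    using det_one_plus_psd_mult(2)[OF pd_imp_psd[OF C] B] m_pos
    unfolding mimo_rate_def logdet_def by (simp add: log_mult del: of_real_prod prod_zero_iff)

  define E :: "complex^'n^'n" where "E = diag_mat (\<lambda>i. if d i > 1 then 1 else 0)"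
  have cE: "cadj E = E"
    by (simp add: E_def)
  have EE: "E ** E = E"
    unfolding E_def diag_mat_mult by (rule arg_cong[of _ _ diag_mat]) auto
  \<comment> \<open>\<open>M\<close> is \<open>Ci\<close> in the diagonalising coordinates. Below,
    \<open>Y\<close> inverts its compression to the range of \<open>E\<close>, padded by the
    identity, and \<open>X\<close> is the same block inverse padded by zeros.\<close>
  define M where "M = cadj S ** Ci ** S"
  have pM: "pd M"
    unfolding M_def using pCi S(3) by (rule pd_congruence)
  define Z where "Z = E ** M ** E + (mat 1 - E)"
  have pZ: "pd Z"
    unfolding Z_def using pM cE EE by (rule pd_compression)
  obtain Y where Y: "Z ** Y = mat 1" "Y ** Z = mat 1"
    using invertible_obtain_inverse[OF pd_invertible[OF pZ]] by blast
  have pY: "pd Y"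
    using pd_inverse[OF pZ Y(1)] .
  have EE_left: "E ** (E ** X) = E ** X" for X :: "complex^'n^'n"
    by (simp add: matrix_mul_assoc EE)
  have ZE: "Z ** E = E ** M ** E" and EZ: "E ** Z = E ** M ** E"
    by (simp_all add: Z_def matrix_ring_simps EE matrix_mul_assoc[symmetric] EE_left)
  have "Y ** (E ** Z) ** Y = Y ** (Z ** E) ** Y"
    by (simp add: ZE EZ)
  then have YE: "Y ** E = E ** Y"
    by (metis Y matrix_mul_assoc matrix_mul_lid matrix_mul_rid)
  define X where "X = E ** Y ** E"
  have X: "X = E ** Y"
    by (simp add: X_def matrix_mul_assoc[symmetric] YE EE_left)
  define V where "V = S ** X ** cadj S"
  have pX: "psd X"
    using psd_congruence[OF pd_imp_psd[OF pY], of E] by (simp add: X_def cE)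
  have pV: "psd V"
    unfolding V_def using pX by (rule psd_congruence')

  \<comment> \<open>Since \<open>X\<close> inverts \<open>M\<close> on the range of
    \<open>E\<close>, it satisfies \<open>X ** M ** X = X\<close>; in the original coordinates this
    is \<open>V ** Ci ** V = V\<close>.\<close>
  have "X ** M ** X = Y ** (E ** M ** E) ** Y"
    using X YE by (metis matrix_mul_assoc)
  also have "\<dots> = X"
    by (simp add: ZE[symmetric] X matrix_mul_assoc Y)
  finally have XMX: "X ** M ** X = X" .
  have "V ** Ci ** V = S ** (X ** M ** X) ** cadj S"
    by (simp add: V_def M_def matrix_mul_assoc)
  then have VCV: "V ** Ci ** V = V"
    by (simp add: XMX V_def)
  \<comment> \<open>\<open>C - V\<close> is reproduced by its own congruence of \<open>Ci\<close>
    and therefore inherits positivity from \<open>Ci\<close>.\<close>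
  have "(C - V) ** Ci ** (C - V) = C ** Ci ** C - C ** Ci ** V - V ** (Ci ** C) + V ** Ci ** V"
    by (simp add: matrix_ring_simps matrix_mul_assoc)
  then have "(C - V) ** Ci ** (C - V) = C - V"
    by (simp add: VCV Ci)
  moreover have "cadj (C - V) = C - V"
    using hermitian_diff[OF pd_imp_hermitian[OF C] psd_imp_hermitian[OF pV]]
    by (simp add: hermitian_def)
  ultimately have CV: "psd (C - V)"
    using psd_congruence[OF pd_imp_psd[OF pCi], of "C - V"] by simp

  \<comment> \<open>Sylvester's identity moves first \<open>S\<close> and then \<open>E\<close>
    around the product; the compressed \<open>M\<close> in \<open>Z\<close> then cancels. The common
    factor \<open>det Y\<close> drops out when \<open>G = A\<close> is compared with
    \<open>G = B\<close>.\<close>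
  have det_V: "det (mat 1 + V ** G) = det Y * det (E ** D ** E + (mat 1 - E))"
    if "cadj S ** (Ci + G) ** S = D" for G D
  proof -
    have SGS: "cadj S ** G ** S = D - M"
      using that unfolding M_def by (simp add: matrix_ring_simps algebra_simps)
    have "V ** G = S ** (E ** (Y ** E ** cadj S ** G))"
      by (simp add: V_def X_def matrix_mul_assoc)
    then have "det (mat 1 + V ** G) = det (mat 1 + E ** (Y ** E ** (cadj S ** G ** S)))"
      using det_one_plus_mult_commute[of S "E ** (Y ** E ** cadj S ** G)"]
      by (simp add: matrix_mul_assoc)
    also have "\<dots> = det (mat 1 + Y ** E ** (D - M) ** E)"
      using det_one_plus_mult_commute[of E "Y ** E ** (D - M)"]
      by (simp add: SGS)
    also have "mat 1 + Y ** E ** (D - M) ** E = Y ** (Z + E ** (D - M) ** E)"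
      by (simp add: matrix_add_ldistrib Y matrix_mul_assoc)
    also have "Z + E ** (D - M) ** E = E ** D ** E + (mat 1 - E)"
      by (simp add: Z_def matrix_ring_simps)
    finally show ?thesis
      by (simp add: det_mul)
  qed
  have "cadj S ** (Ci + A) ** S = diag_mat d"
    unfolding RA using S(1) by (rule congruence_inverse)
  \<comment> \<open>The compression keeps the entries \<open>d i > 1\<close> and the padding puts 1
    elsewhere, which is \<open>m\<close>.\<close>
  moreover have "E ** diag_mat d ** E + (mat 1 - E) = diag_mat m"
    unfolding E_def mat_1_eq_diag_mat diag_mat_mult diag_mat_diff diag_mat_add
    by (rule arg_cong[of _ _ diag_mat]) (auto simp: m_def)
  ultimately have VA: "det (mat 1 + V ** A) = det Y * of_real (prod m UNIV)"
    using det_V[of A "diag_mat d"] by (simp add: det_diag_mat)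
  have "cadj S ** (Ci + B) ** S = mat 1"
    using congruence_inverse[OF S(1), of "mat 1"] by (simp add: RB)
  then have VB: "det (mat 1 + V ** B) = det Y"
    using det_V[of B "mat 1"] by (simp add: EE)
  have "mimo_rate V A = mimo_rate V B + log 2 (prod m UNIV)"
    using pd_det(2)[OF pY] m_pos unfolding mimo_rate_def logdet_def VA VB
    by (simp add: log_mult del: of_real_prod prod_zero_iff)
  then show thesis
    using that[OF NA NB pV CV] CN by simp
qed

section \<open>From rates of Gram matrices to \<open>RAstar\<close>\<close>

lemma RA_eq_mimo_rate:
  fixes HDS :: "complex^'s::finite^'d::finite" and HRS :: "complex^'s^'r::finite"
  assumes "psd V" "psd W"
  shows "RA HDS HRS V W = mimo_rate V (cadj HDS ** HDS)
    + mimo_rate (V + W) (cadj HRS ** HRS) - mimo_rate V (cadj HRS ** HRS)"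
proof -
  have "0 < Re (det (mat 1 + HRS ** V ** cadj HRS))" "0 < Re (det (mat 1 + HRS ** (V + W) ** cadj HRS))"
    by (intro pd_det pd_one_plus_congruence assms psd_add)+
  then show ?thesis
    unfolding RA_def logdet_one_plus_conj[symmetric] logdet_def by (simp add: log_divide)
qed

lemma RA_le_mimo_rate:
  fixes HDS :: "complex^'s::finite^'d::finite" and HRS :: "complex^'s^'r::finite"
  assumes "psd (N - cadj HDS ** HDS)" "psd (N - cadj HRS ** HRS)"
    and "psd V" "psd W" "psd (C - (V + W))"
  shows "RA HDS HRS V W \<le> mimo_rate C N"
  using mimo_rate_enhanced_bound[OF psd_gram psd_gram assms] by (simp add: RA_eq_mimo_rate assms)

lemma RAstar_le_mimo_rate:
  fixes HDS :: "complex^'s::finite^'d::finite" and HRS :: "complex^'s^'r::finite"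
  assumes "psd (N - cadj HDS ** HDS)" "psd (N - cadj HRS ** HRS)" "psd C"
  shows "RAstar HDS HRS C \<le> mimo_rate C N"
  unfolding RAstar_def
proof (rule cSup_least)
  \<comment> \<open>The zero splitting is admissible because \<open>C\<close> is positive
    semidefinite, so the supremum is over a nonempty set.\<close>
  have "RA HDS HRS 0 0 \<in> {RA HDS HRS V W |V W. psd V \<and> psd W \<and> psd (C - (V + W))}"
    using assms(3) psd_0 by (auto intro!: exI[of _ 0])
  then show "{RA HDS HRS V W |V W. psd V \<and> psd W \<and> psd (C - (V + W))} \<noteq> {}"
    by blast
qed (use RA_le_mimo_rate[OF assms(1,2)] in blast)

text \<open>The matrix \<open>V\<close> of the attainment lemma, with \<open>W = C - V\<close>,
  reaches the bound given by \<open>N\<close>. The same \<open>N\<close> bounds all splittings, so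
  the supremum is a maximum.\<close>

lemma RAstar_eq_mimo_rate:
  fixes HDS :: "complex^'s::finite^'d::finite" and HRS :: "complex^'s^'r::finite"
  assumes C: "pd C"
  obtains N where "psd (N - cadj HDS ** HDS)" "psd (N - cadj HRS ** HRS)"
    "RAstar HDS HRS C = mimo_rate C N"
proof -
  obtain N V where N: "psd (N - cadj HDS ** HDS)" "psd (N - cadj HRS ** HRS)"
    and V: "psd V" "psd (C - V)"
    and eq: "mimo_rate V (cadj HDS ** HDS) + mimo_rate C (cadj HRS ** HRS) - mimo_rate V (cadj HRS ** HRS)
      = mimo_rate C N"
    using mimo_rate_enhanced_attained[OF C psd_gram psd_gram] by blast
  have "RA HDS HRS V (C - V) = mimo_rate C N"
    by (simp add: RA_eq_mimo_rate V eq)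
  moreover have "psd (C - (V + (C - V)))"
    by (simp add: psd_0)
  ultimately have "mimo_rate C N \<in> {RA HDS HRS V W |V W. psd V \<and> psd W \<and> psd (C - (V + W))}"
    using V by (metis (mono_tags, lifting) mem_Collect_eq)
  moreover have "bdd_above {RA HDS HRS V W |V W. psd V \<and> psd W \<and> psd (C - (V + W))}"
    using RA_le_mimo_rate[OF N] by (auto intro!: bdd_aboveI[of _ "mimo_rate C N"])
  ultimately have "mimo_rate C N \<le> RAstar HDS HRS C"
    unfolding RAstar_def by (rule cSup_upper)
  then show thesis
    using that N RAstar_le_mimo_rate[OF N pd_imp_psd[OF C]] by (simp add: order_antisym)
qed

lemma convex_pd: "convex {C. pd C}"
  unfolding convex_alt
proof (intro ballI allI impI, elim conjE)
  fix C C' :: "complex^'n^'n" and t :: real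
  assume "C \<in> {C. pd C}" "C' \<in> {C. pd C}" "0 \<le> t" "t \<le> 1"
  then show "(1 - t) *\<^sub>R C + t *\<^sub>R C' \<in> {C. pd C}"
    by (cases "t = 0") (simp_all add: psd_add_pd pd_scaleR psd_scaleR pd_imp_psd)
qed

text \<open>The matrix \<open>N\<close> is chosen to be tight at the mixture. It still bounds
  \<open>RAstar\<close> at both endpoints, and \<open>mimo_rate\<close> is concave in the covariance
  for fixed \<open>N\<close>.\<close>

lemma concave_RAstar:
  fixes HDS :: "complex^'s::finite^'d::finite" and HRS :: "complex^'s^'r::finite"
  assumes C: "pd C" and C': "pd C'" and t: "0 \<le> t" "t \<le> 1"
  shows "(1 - t) * RAstar HDS HRS C + t * RAstar HDS HRS C' \<le> RAstar HDS HRS ((1 - t) *\<^sub>R C + t *\<^sub>R C')"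
proof -
  have "pd ((1 - t) *\<^sub>R C + t *\<^sub>R C')"
    using convex_pd C C' t unfolding convex_alt by blast
  then obtain N where N: "psd (N - cadj HDS ** HDS)" "psd (N - cadj HRS ** HRS)"
    and eq: "RAstar HDS HRS ((1 - t) *\<^sub>R C + t *\<^sub>R C') = mimo_rate ((1 - t) *\<^sub>R C + t *\<^sub>R C') N"
    using RAstar_eq_mimo_rate by blast
  have "psd N"
    using psd_add[OF N(1) psd_gram[of HDS]] by simp
  note psd = pd_imp_psd[OF C] pd_imp_psd[OF C']
  have "(1 - t) * RAstar HDS HRS C + t * RAstar HDS HRS C'
      \<le> (1 - t) * mimo_rate C N + t * mimo_rate C' N"
    using t by (intro add_mono mult_left_mono RAstar_le_mimo_rate N psd) auto
  also have "\<dots> \<le> RAstar HDS HRS ((1 - t) *\<^sub>R C + t *\<^sub>R C')"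
    unfolding eq using psd \<open>psd N\<close> t by (rule mimo_rate_concave)
  finally show ?thesis .
qed

text \<open>The matrix inside the determinant is jointly affine in \<open>C\<close> and
  \<open>R\<close>.\<close>

lemma concave_RB:
  fixes HDS :: "complex^'s::finite^'d::finite" and HDR :: "complex^'r::finite^'d"
  assumes C: "psd C" "psd C'" and R: "psd R" "psd R'" and t: "0 \<le> t" "t \<le> 1"
  shows "(1 - t) * RB HDS HDR C R + t * RB HDS HDR C' R'
    \<le> RB HDS HDR ((1 - t) *\<^sub>R C + t *\<^sub>R C') ((1 - t) *\<^sub>R R + t *\<^sub>R R')"
proof -
  let ?H = "blockH HDS HDR"
  let ?G = "\<lambda>C R. mat 1 + HDS ** C ** cadj HDS + ?H ** R ** cadj ?H"
  have pd: "pd (?G C R)" if "psd C" "psd R" for C R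
    using that by (intro pd_add_psd pd_one_plus_congruence psd_congruence')
  have "?G ((1 - t) *\<^sub>R C + t *\<^sub>R C') ((1 - t) *\<^sub>R R + t *\<^sub>R R') = (1 - t) *\<^sub>R ?G C R + t *\<^sub>R ?G C' R'"
    by (simp add: matrix_ring_simps matrix_scalar_ac scalar_matrix_assoc[symmetric] algebra_simps)
  then show ?thesis
    using logdet_concave[OF pd[OF C(1) R(1)] pd[OF C(2) R(2)] t] by (simp add: RB_def logdet_def)
qed

section \<open>Convexity of the feasible set and conclusion\<close>

lemma Re_trace_add: "Re (trace (A + B)) = Re (trace A) + Re (trace B)"
  by (simp add: trace_add)

lemma Re_trace_scaleR: "Re (trace (c *\<^sub>R A)) = c * Re (trace A)" for A :: "complex^'n^'n"
  by (simp add: trace_def sum_distrib_left)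

lemma convex_Peps:
  "convex (Peps PS PR \<epsilon> :: ((complex^'s::finite^'s) \<times> (complex^('s + 'r::finite)^('s + 'r))) set)"
  unfolding convex_alt
proof (intro ballI allI impI, elim conjE)
  fix p q :: "(complex^'s^'s) \<times> (complex^('s + 'r)^('s + 'r))" and t :: real
  assume p: "p \<in> Peps PS PR \<epsilon>" and q: "q \<in> Peps PS PR \<epsilon>" and t: "0 \<le> t" "t \<le> 1"
  obtain C R C' R' where pq: "p = (C, R)" "q = (C', R')"
    by (cases p, cases q)
  let ?mix = "\<lambda>x y. (1 - t) *\<^sub>R x + t *\<^sub>R y"
  have mix_le: "(1 - t) * a + t * b \<le> c" if "a \<le> c" "b \<le> c" for a b c :: real
    using convex_bound_le[OF that, of "1 - t" t] t by simp
  let ?DS = "DS :: complex^('s + 'r)^'s" and ?DR = "DR :: complex^('s + 'r)^'r"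
  note simps = matrix_ring_simps matrix_scalar_ac scalar_matrix_assoc[symmetric]
    Re_trace_add Re_trace_scaleR
  have "psd (?mix (C - mat \<epsilon>) (C' - mat \<epsilon>))"
    using p q t unfolding pq Peps_def by (auto intro!: psd_add psd_scaleR)
  then have "psd (?mix C C' - mat \<epsilon>)"
    by (simp add: algebra_simps)
  moreover have "psd (?mix R R')"
    using p q t unfolding pq Peps_def by (auto intro!: psd_add psd_scaleR)
  moreover have "Re (trace (?mix C C')) + Re (trace (?DS ** ?mix R R' ** cadj ?DS)) \<le> PS"
  proof -
    have "Re (trace (?mix C C')) + Re (trace (?DS ** ?mix R R' ** cadj ?DS))
      = (1 - t) * (Re (trace C) + Re (trace (?DS ** R ** cadj ?DS)))
        + t * (Re (trace C') + Re (trace (?DS ** R' ** cadj ?DS)))"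
      by (simp add: simps distrib_left)
    also have "\<dots> \<le> PS"
      using p q unfolding pq Peps_def by (intro mix_le) auto
    finally show ?thesis .
  qed
  moreover have "Re (trace (?DR ** ?mix R R' ** cadj ?DR)) \<le> PR"
  proof -
    have "Re (trace (?DR ** ?mix R R' ** cadj ?DR))
      = (1 - t) * Re (trace (?DR ** R ** cadj ?DR)) + t * Re (trace (?DR ** R' ** cadj ?DR))"
      by (simp add: simps)
    also have "\<dots> \<le> PR"
      using p q unfolding pq Peps_def by (intro mix_le) auto
    finally show ?thesis .
  qed
  ultimately show "?mix p q \<in> Peps PS PR \<epsilon>"
    by (simp add: pq Peps_def)
qed

text \<open>This is where \<open>\<epsilon> > 0\<close> enters: it makes \<open>C\<close>
  invertible, as the attainment argument requires.\<close>

lemma psd_diff_mat_imp_pd: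
  fixes C :: "complex^'n^'n"
  assumes "psd (C - mat (complex_of_real \<epsilon>))" "0 < \<epsilon>"
  shows "pd C"
proof -
  have "mat (complex_of_real \<epsilon>) = \<epsilon> *\<^sub>R (mat 1 :: complex^'n^'n)"
    by (simp add: vec_eq_iff mat_def scaleR_conv_of_real[where 'a = complex])
  then have "pd (mat (complex_of_real \<epsilon>) :: complex^'n^'n)"
    using pd_scaleR[OF pd_mat_1 assms(2)] by simp
  from psd_add_pd[OF assms(1) this] show ?thesis
    by simp
qed

theorem theorem1:
  fixes HDS :: "complex^'s::finite^'d::finite"
    and HRS :: "complex^'s^'r::finite"
    and HDR :: "complex^'r^'d"
    and PS PR \<epsilon> :: real
  assumes "PS > 0" and "PR > 0" and "\<epsilon> > 0"
  shows "convex (Peps PS PR \<epsilon> :: ((complex^'s^'s) \<times> (complex^('s + 'r)^('s + 'r))) set)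
    \<and> concave_on (Peps PS PR \<epsilon> :: ((complex^'s^'s) \<times> (complex^('s + 'r)^('s + 'r))) set)
        (\<lambda>(C, R). min (RAstar HDS HRS C) (RB HDS HDR C R))"
proof
  let ?P = "Peps PS PR \<epsilon> :: ((complex^'s^'s) \<times> (complex^('s + 'r)^('s + 'r))) set"
  let ?f = "\<lambda>(C, R). min (RAstar HDS HRS C) (RB HDS HDR C R)"
  show "convex ?P"
    by (rule convex_Peps)
  show "concave_on ?P ?f"
    unfolding concave_on_def
  proof (rule convex_onI)
    fix t :: real and p q :: "(complex^'s^'s) \<times> (complex^('s + 'r)^('s + 'r))"
    assume t: "0 < t" "t < 1" and p: "p \<in> ?P" and q: "q \<in> ?P"
    obtain C R C' R' where pq: "p = (C, R)" "q = (C', R')"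
      by (cases p, cases q)
    have pd: "pd C" "pd C'" and R: "psd R" "psd R'"
      using p q psd_diff_mat_imp_pd \<open>\<epsilon> > 0\<close> unfolding pq Peps_def by auto
    have t': "0 \<le> t" "t \<le> 1" using t by auto
    have "(1 - t) * RAstar HDS HRS C + t * RAstar HDS HRS C' \<le> RAstar HDS HRS ((1 - t) *\<^sub>R C + t *\<^sub>R C')"
      using concave_RAstar[OF pd t'] .
    moreover have "(1 - t) * RB HDS HDR C R + t * RB HDS HDR C' R'
        \<le> RB HDS HDR ((1 - t) *\<^sub>R C + t *\<^sub>R C') ((1 - t) *\<^sub>R R + t *\<^sub>R R')"
      using concave_RB[OF pd_imp_psd[OF pd(1)] pd_imp_psd[OF pd(2)] R t'] .
    \<comment> \<open>Superadditivity of the minimum under mixing: the minimum of two concave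
      functions is concave.\<close>
    moreover have "(1 - t) * min a b + t * min a' b' \<le> min ((1 - t) * a + t * a') ((1 - t) * b + t * b')"
      for a b a' b' :: real
      using t by (auto intro!: add_mono mult_left_mono)
    ultimately have "(1 - t) * ?f p + t * ?f q \<le> ?f ((1 - t) *\<^sub>R p + t *\<^sub>R q)"
      unfolding pq by (simp add: min.coboundedI1 min.coboundedI2) (meson order_trans)
    then show "- ?f ((1 - t) *\<^sub>R p + t *\<^sub>R q) \<le> (1 - t) * - ?f p + t * - ?f q"
      by simp
  qed (rule convex_Peps)
qed

end
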